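(* Let $p \in (1,\infty)$, and let $\mathcal{F}$ be a non-empty subset of $\mathcal{P}_p(\mathbb{R})$ which is displacement convex and closed with respect to $\mathcal{W}_p$. Let $T:\mathbb{R}\to\mathbb{R}$ be a nondegenerate affine transformation $T(x) = a + bx$, where $a\in\mathbb{R}$ and $b\in\mathbb{R}\setminus\{0\}$, and suppose that $\mathcal{F}$ is invariant under $T$, that is, $$\mathcal{F} = T_{\#}\mathcal{F} := \{T_{\#}\nu : \nu\in\mathcal{F}\}.$$ Then, for any $\mu\in\mathcal{P}_p(\mathbb{R})$, $$\mathrm{proj}_{\mathcal{F}}^{(p)}(T_{\#}\mu) = T_{\#}\big(\mathrm{proj}_{\mathcal{F}}^{(p)}\mu\big).$$
   Context: $\mathcal{P}_p(\mathbb{R})$ is the set of Borel probability measures on $\mathbb{R}$ with finite $p$-th moment. $T_{\#}\mu = \mu\circ T^{-1}$ is the pushforward. $\mathcal{W}_p(\mu,\nu) = \left(\inf_{\pi} \int |x-y|^p\,d\pi(x,y)\right)^{1/p}$, the infimum being over all couplings $\pi$ of $\mu$ and $\nu$. The quantile function of $\mu$ is $Q_\mu(u) = \inf\{x : \mu((-\infty,x]) \ge u\}$, $u\in(0,1)$. A set $\mathcal{F}$ of Borel probability measures on $\mathbb{R}$ is displacement convex if $\{Q_\mu : \mu\in\mathcal{F}\}$ is a convex set of functions. For $\mathcal{F}$ as in the claim and $\mu\in\mathcal{P}_p(\mathbb{R})$, $\mathrm{proj}_{\mathcal{F}}^{(p)}\mu$ denotes the unique minimizer (which exists) of $\nu\mapsto\mathcal{W}_p(\nu,\mu)$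 over $\nu\in\mathcal{F}$. *)

theory Defs
  imports "HOL-Probability.Probability"
begin

definition Pp :: "real \<Rightarrow> real measure set" where
  "Pp p = {\<mu>. real_distribution \<mu> \<and> integrable \<mu> (\<lambda>x. \<bar>x\<bar> powr p)}"

definition couplings :: "real measure \<Rightarrow> real measure \<Rightarrow> (real \<times> real) measure set" where
  "couplings \<mu> \<nu> = {\<pi>. prob_space \<pi> \<and> sets \<pi> = sets (borel \<Otimes>\<^sub>M borel) \<and>
     distr \<pi> borel fst = \<mu> \<and> distr \<pi> borel snd = \<nu>}"

text \<open>The infimum is finite whenever both arguments lie in \<open>Pp p\<close>, so \<^const>\<open>enn2real\<close> (which
  sends infinity to 0) loses nothing there.\<close>

definition Wp :: "real \<Rightarrow> real measure \<Rightarrow> real measure \<Rightarrow> real" where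
  "Wp p \<mu> \<nu> =
     enn2real (INF \<pi>\<in>couplings \<mu> \<nu>. \<integral>\<^sup>+ z. ennreal (\<bar>fst z - snd z\<bar> powr p) \<partial>\<pi>) powr (1 / p)"

definition quantile :: "real measure \<Rightarrow> real \<Rightarrow> real" where
  "quantile \<mu> u = Inf {x. u \<le> cdf \<mu> x}"

text \<open>Convexity of the set of quantile functions, written out because functions on the open
  unit interval do not form a type; values of \<^const>\<open>quantile\<close> outside it are meaningless.\<close>

definition displacement_convex :: "real measure set \<Rightarrow> bool" where
  "displacement_convex F \<longleftrightarrow>
     (\<forall>\<mu>\<in>F. \<forall>\<nu>\<in>F. \<forall>t\<in>{0..1}. \<exists>\<sigma>\<in>F. \<forall>u\<in>{0<..<1}.
        quantile \<sigma> u = (1 - t) * quantile \<mu> u + t * quantile \<nu> u)"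

text \<open>Closedness as a subset of the metric space \<open>(Pp p, Wp p)\<close>, by sequences.\<close>

definition Wp_closed :: "real \<Rightarrow> real measure set \<Rightarrow> bool" where
  "Wp_closed p F \<longleftrightarrow>
     (\<forall>\<nu> \<sigma>. (\<forall>n::nat. \<nu> n \<in> F) \<longrightarrow> \<sigma> \<in> Pp p \<longrightarrow> (\<lambda>n. Wp p (\<nu> n) \<sigma>) \<longlonglongrightarrow> 0 \<longrightarrow> \<sigma> \<in> F)"

definition proj :: "real \<Rightarrow> real measure set \<Rightarrow> real measure \<Rightarrow> real measure" where
  "proj p F \<mu> = (THE \<nu>. is_arg_min (\<lambda>\<nu>. Wp p \<nu> \<mu>) (\<lambda>\<nu>. \<nu> \<in> F) \<nu>)"

end

theory Submission
  imports Defs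
begin

text \<open>
  On the line the quantile coupling is optimal for every cost \<open>\<bar>x - y\<bar>\<^sup>p\<close>, so
  \<open>W\<^sub>p\<close> is the \<open>L\<^sup>p\<close> distance of quantile functions and \<open>F\<close> becomes
  a convex set in \<open>L\<^sup>p(0,1)\<close>. Uniform convexity of \<open>L\<^sup>p\<close> makes near-minimizers of the
  distance to \<open>\<mu>\<close> close to each other: hence minimizers are unique, and a minimizing sequence is
  Cauchy. The law of its \<open>L\<^sup>p\<close> limit lies in \<open>F\<close> by closedness, and is a minimizer by Fatou; only
  the upper bound \<open>W\<^sub>p\<^sup>p \<le> E \<bar>X - Y\<bar>\<^sup>p\<close> is needed there, so the limit need not be known to be a
  quantile function. Since \<open>T\<close> multiplies all \<open>W\<^sub>p\<close> distances by \<open>\<bar>b\<bar>\<close> and preserves \<open>F\<close>, it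
  carries the minimizer for \<open>\<mu>\<close> to a minimizer for the image of \<open>\<mu>\<close>.
\<close>

section \<open>Uniform convexity and completeness of \<open>L\<^sup>p\<close>\<close>

text \<open>Strict midpoint convexity of the \<open>p\<close>-th power at 1 and \<open>t\<close>.
  For \<open>t \<le> 0\<close> the midpoint is at most 1/2 in absolute value, and its power falls
  below 1/2 because \<open>p > 1\<close>. For positive \<open>t\<close> the convexity gap vanishes
  at 1 and is strictly decreasing up to there.\<close>

lemma powr_midpoint_less:
  fixes p t :: real
  assumes p: "1 < p" and t: "-1 \<le> t" "t < 1"
  shows "\<bar>(1 + t) / 2\<bar> powr p < (1 + \<bar>t\<bar> powr p) / 2"
proof (cases "t \<le> 0")
  case True
  have "\<bar>(1 + t) / 2\<bar> powr p \<le> (1 / 2) powr p"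
    using True t p by (intro powr_mono2) auto
  also have "\<dots> < (1 / 2) powr 1"
    using p by (intro powr_less_mono') auto
  also have "\<dots> \<le> (1 + \<bar>t\<bar> powr p) / 2"
    by simp
  finally show ?thesis .
next
  case False
  define h where "h s = (1 + s powr p) / 2 - ((1 + s) / 2) powr p" for s :: real
  have "h 1 < h t"
  proof (rule DERIV_neg_imp_decreasing_open[OF \<open>t < 1\<close>])
    fix s assume s: "t < s" "s < 1"
    have "(h has_real_derivative p / 2 * (s powr (p - 1) - ((1 + s) / 2) powr (p - 1))) (at s)"
      unfolding h_def using s False
      by (auto intro!: derivative_eq_intros simp: algebra_simps)
    moreover have "p / 2 * (s powr (p - 1) - ((1 + s) / 2) powr (p - 1)) < 0"
      using s False p by (auto intro!: mult_pos_neg powr_less_mono2)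
    ultimately show "\<exists>y. (h has_real_derivative y) (at s) \<and> y < 0"
      by blast
  next
    show "continuous_on {t..1} h"
      unfolding h_def using False by (intro continuous_intros) auto
  qed
  then show ?thesis
    using False by (simp add: h_def)
qed

text \<open>A compactness argument in the ratio \<open>t\<close>. Close to 1,
  \<open>\<bar>1 - t\<bar> powr p\<close> is itself below \<open>e\<close>. Away from 1 the
  convexity gap has a positive minimum, so a large multiple \<open>C\<close> of it exceeds
  \<open>2 powr p\<close>, the largest possible value of that term.\<close>

lemma powr_uniform_convex_unit:
  fixes p e :: real
  assumes p: "1 < p" and e: "0 < e"
  obtains C where "0 \<le> C"
    "\<And>t. \<bar>t\<bar> \<le> 1 \<Longrightarrow> \<bar>1 - t\<bar> powr p + C * \<bar>(1 + t) / 2\<bar> powr p \<le> (e + C / 2) * (1 + \<bar>t\<bar> powr p)"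
proof -
  \<comment> \<open>The radius of the neighbourhood of 1 in which \<open>r powr p \<le> e\<close>
    already suffices; the cap at 1 keeps the remaining interval nonempty.\<close>
  define r where "r = min 1 (e powr (1 / p))"
  have r: "0 < r" "r \<le> 1" "r powr p \<le> e"
  proof -
    show "0 < r" "r \<le> 1"
      using e by (auto simp: r_def)
    have "r powr p \<le> (e powr (1 / p)) powr p"
      using p e by (intro powr_mono2) (auto simp: r_def)
    also have "\<dots> = e"
      using p e by (simp add: powr_powr)
    finally show "r powr p \<le> e" .
  qed
  define h where "h t = (1 + \<bar>t\<bar> powr p) / 2 - \<bar>(1 + t) / 2\<bar> powr p" for t :: real
  have "continuous_on {-1..1 - r} h"
    unfolding h_def using p by (intro continuous_intros continuous_on_powr') auto
  then obtain s where s: "s \<in> {-1..1 - r}" "\<And>t. t \<in> {-1..1 - r} \<Longrightarrow> h s \<le> h t"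
    using continuous_attains_inf[of "{-1..1 - r}" h] r by auto
  have hs: "0 < h s"
    using powr_midpoint_less[OF p, of s] s r by (auto simp: h_def)
  define C where "C = 2 powr p / h s"
  have C: "0 \<le> C"
    using hs by (simp add: C_def)
  have "\<bar>1 - t\<bar> powr p \<le> e * (1 + \<bar>t\<bar> powr p) + C * h t" if t: "\<bar>t\<bar> \<le> 1" for t
  proof (cases "t \<le> 1 - r")
    case True
    have "\<bar>1 - t\<bar> powr p \<le> 2 powr p"
      using t p by (intro powr_mono2) auto
    also have "\<dots> = C * h s"
      using hs by (simp add: C_def)
    also have "\<dots> \<le> C * h t"
      using True t C by (intro mult_left_mono s) auto
    also have "\<dots> \<le> e * (1 + \<bar>t\<bar> powr p) + C * h t"
      using e by simp
    finally show ?thesis .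
  next
    case False
    have "\<bar>1 - t\<bar> powr p \<le> r powr p"
      using False t p by (intro powr_mono2) auto
    also have "\<dots> \<le> e"
      by (rule r)
    also have "\<dots> \<le> e * (1 + \<bar>t\<bar> powr p)"
      using e by (simp add: algebra_simps)
    finally have *: "\<bar>1 - t\<bar> powr p \<le> e * (1 + \<bar>t\<bar> powr p)" .
    have "0 \<le> h t"
    proof (cases "t = 1")
      case True
      then show ?thesis by (simp add: h_def)
    next
      case False
      then have "-1 \<le> t" "t < 1"
        using t by auto
      from powr_midpoint_less[OF p this] show ?thesis
        by (simp add: h_def)
    qed
    then have "0 \<le> C * h t"
      using C by simp
    with * show ?thesis by simp
  qed
  then have "\<bar>1 - t\<bar> powr p + C * \<bar>(1 + t) / 2\<bar> powr p \<le> (e + C / 2) * (1 + \<bar>t\<bar> powr p)"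
    if "\<bar>t\<bar> \<le> 1" for t
    using that by (fastforce simp: h_def algebra_simps add_divide_distrib)
  with C show ?thesis
    by (rule that)
qed

text \<open>The midpoint term stands on the left so that the inequality survives integration in
  \<^typ>\<open>ennreal\<close>, where subtraction truncates.\<close>

lemma powr_uniform_convex:
  fixes p e :: real
  assumes p: "1 < p" and e: "0 < e"
  obtains C where "0 \<le> C"
    "\<And>x y. \<bar>x - y\<bar> powr p + C * \<bar>(x + y) / 2\<bar> powr p
       \<le> (e + C / 2) * (\<bar>x\<bar> powr p + \<bar>y\<bar> powr p)"
proof -
  obtain C where C: "0 \<le> C" and unit: "\<And>t. \<bar>t\<bar> \<le> 1 \<Longrightarrow>
      \<bar>1 - t\<bar> powr p + C * \<bar>(1 + t) / 2\<bar> powr p \<le> (e + C / 2) * (1 + \<bar>t\<bar> powr p)"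
    using powr_uniform_convex_unit[OF p e] by blast
  \<comment> \<open>Both sides are homogeneous of degree \<open>p\<close>: dividing by the entry of
    larger absolute value reduces to the ratio \<open>t = y / x\<close>. Symmetry in
    \<open>x\<close> and \<open>y\<close> covers the other case.\<close>
  have le: "\<bar>x - y\<bar> powr p + C * \<bar>(x + y) / 2\<bar> powr p
      \<le> (e + C / 2) * (\<bar>x\<bar> powr p + \<bar>y\<bar> powr p)" if "\<bar>y\<bar> \<le> \<bar>x\<bar>" for x y
  proof (cases "x = 0")
    case True
    then show ?thesis
      using that by simp
  next
    case False
    have scale: "\<bar>x * s\<bar> powr p = \<bar>x\<bar> powr p * \<bar>s\<bar> powr p" for s
      by (simp add: abs_mult powr_mult)
    have "x - y = x * (1 - y / x)" "(x + y) / 2 = x * ((1 + y / x) / 2)" "y = x * (y / x)"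
      using False by (auto simp: field_simps)
    then have eq: "\<bar>x - y\<bar> powr p = \<bar>x\<bar> powr p * \<bar>1 - y / x\<bar> powr p"
      "\<bar>(x + y) / 2\<bar> powr p = \<bar>x\<bar> powr p * \<bar>(1 + y / x) / 2\<bar> powr p"
      "\<bar>y\<bar> powr p = \<bar>x\<bar> powr p * \<bar>y / x\<bar> powr p"
      by (metis scale)+
    have "\<bar>y / x\<bar> \<le> 1"
      using that False by (simp add: abs_divide)
    from mult_left_mono[OF unit[OF this], of "\<bar>x\<bar> powr p"] show ?thesis
      unfolding eq by (simp add: algebra_simps)
  qed
  have "\<bar>x - y\<bar> powr p + C * \<bar>(x + y) / 2\<bar> powr p
      \<le> (e + C / 2) * (\<bar>x\<bar> powr p + \<bar>y\<bar> powr p)" for x y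
    using le[of x y] le[of y x] by (cases "\<bar>y\<bar> \<le> \<bar>x\<bar>") (auto simp: abs_minus_commute add.commute)
  with C show ?thesis
    by (rule that)
qed

lemma abs_add_powr_le:
  fixes x y p :: real
  assumes "0 \<le> p"
  shows "\<bar>x + y\<bar> powr p \<le> 2 powr p * (\<bar>x\<bar> powr p + \<bar>y\<bar> powr p)"
proof -
  have "\<bar>x + y\<bar> powr p \<le> (2 * max \<bar>x\<bar> \<bar>y\<bar>) powr p"
    using assms by (intro powr_mono2) auto
  also have "\<dots> = 2 powr p * max \<bar>x\<bar> \<bar>y\<bar> powr p"
    by (simp add: powr_mult)
  also have "\<dots> \<le> 2 powr p * (\<bar>x\<bar> powr p + \<bar>y\<bar> powr p)"
    by (intro mult_left_mono) (auto simp: max_def)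
  finally show ?thesis .
qed

text \<open>Integrates the pointwise inequality. \<open>C\<close> is fixed before the measure and
  the functions, a uniformity on which the choice of \<open>\<delta>\<close> below depends.\<close>

lemma nn_integral_uniform_convex:
  fixes p e :: real
  assumes p: "1 < p" and e: "0 < e"
  obtains C where "0 \<le> C"
    "\<And>(M :: 'a measure) f g. f \<in> borel_measurable M \<Longrightarrow> g \<in> borel_measurable M \<Longrightarrow>
       (\<integral>\<^sup>+x. ennreal (\<bar>f x - g x\<bar> powr p) \<partial>M) + ennreal C * (\<integral>\<^sup>+x. ennreal (\<bar>(f x + g x) / 2\<bar> powr p) \<partial>M)
       \<le> ennreal (e + C / 2) * ((\<integral>\<^sup>+x. ennreal (\<bar>f x\<bar> powr p) \<partial>M) + (\<integral>\<^sup>+x. ennreal (\<bar>g x\<bar> powr p) \<partial>M))"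
proof -
  obtain C where C: "0 \<le> C" and le: "\<And>x y. \<bar>x - y\<bar> powr p + C * \<bar>(x + y) / 2\<bar> powr p
       \<le> (e + C / 2) * (\<bar>x\<bar> powr p + \<bar>y\<bar> powr p)"
    using powr_uniform_convex[OF p e] by blast
  have "(\<integral>\<^sup>+x. ennreal (\<bar>f x - g x\<bar> powr p) \<partial>M) + ennreal C * (\<integral>\<^sup>+x. ennreal (\<bar>(f x + g x) / 2\<bar> powr p) \<partial>M)
       \<le> ennreal (e + C / 2) * ((\<integral>\<^sup>+x. ennreal (\<bar>f x\<bar> powr p) \<partial>M) + (\<integral>\<^sup>+x. ennreal (\<bar>g x\<bar> powr p) \<partial>M))"
    if [measurable]: "f \<in> borel_measurable M" "g \<in> borel_measurable M" for M :: "'a measure" and f g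
  proof -
    have "(\<integral>\<^sup>+x. ennreal (\<bar>f x - g x\<bar> powr p) \<partial>M) + ennreal C * (\<integral>\<^sup>+x. ennreal (\<bar>(f x + g x) / 2\<bar> powr p) \<partial>M)
        = (\<integral>\<^sup>+x. ennreal (\<bar>f x - g x\<bar> powr p + C * \<bar>(f x + g x) / 2\<bar> powr p) \<partial>M)"
      using C by (simp add: nn_integral_add nn_integral_cmult ennreal_mult)
    also have "\<dots> \<le> (\<integral>\<^sup>+x. ennreal ((e + C / 2) * (\<bar>f x\<bar> powr p + \<bar>g x\<bar> powr p)) \<partial>M)"
      by (intro nn_integral_mono ennreal_leI le)
    also have "\<dots> = ennreal (e + C / 2) * ((\<integral>\<^sup>+x. ennreal (\<bar>f x\<bar> powr p) \<partial>M) + (\<integral>\<^sup>+x. ennreal (\<bar>g x\<bar> powr p) \<partial>M))"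
      using C e by (simp add: nn_integral_add nn_integral_cmult ennreal_mult)
    finally show ?thesis .
  qed
  with C show ?thesis
    by (rule that)
qed

text \<open>With the midpoint bounded below by \<open>D\<close>, uniform convexity leaves at most
  \<open>2 * e * (D + \<delta>) + C * \<delta>\<close> for the integral of the difference. First
  \<open>e\<close> makes the first term small, which fixes \<open>C\<close>; then
  \<open>\<delta>\<close> makes the second term small.\<close>

lemma near_minimizers_close:
  fixes p D \<eta> :: real
  assumes p: "1 < p" and D: "0 \<le> D" and \<eta>: "0 < \<eta>"
  obtains \<delta> where "0 < \<delta>"
    "\<And>(M :: 'a measure) f g. f \<in> borel_measurable M \<Longrightarrow> g \<in> borel_measurable M \<Longrightarrow>
       (\<integral>\<^sup>+x. ennreal (\<bar>f x\<bar> powr p) \<partial>M) \<le> ennreal (D + \<delta>) \<Longrightarrow>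
       (\<integral>\<^sup>+x. ennreal (\<bar>g x\<bar> powr p) \<partial>M) \<le> ennreal (D + \<delta>) \<Longrightarrow>
       ennreal D \<le> (\<integral>\<^sup>+x. ennreal (\<bar>(f x + g x) / 2\<bar> powr p) \<partial>M) \<Longrightarrow>
       (\<integral>\<^sup>+x. ennreal (\<bar>f x - g x\<bar> powr p) \<partial>M) \<le> ennreal \<eta>"
proof -
  \<comment> \<open>Chosen so that \<open>2 * e * (D + 1) = \<eta> / 2\<close>; the added 1 absorbs
    \<open>\<delta> \<le> 1\<close> and keeps the denominator positive when
    \<open>D = 0\<close>.\<close>
  define e where "e = \<eta> / 4 / (D + 1)"
  have e: "0 < e"
    using D \<eta> by (simp add: e_def)
  obtain C where C: "0 \<le> C" and uc: "\<And>(M :: 'a measure) f g. f \<in> borel_measurable M \<Longrightarrow> g \<in> borel_measurable M \<Longrightarrow>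
       (\<integral>\<^sup>+x. ennreal (\<bar>f x - g x\<bar> powr p) \<partial>M) + ennreal C * (\<integral>\<^sup>+x. ennreal (\<bar>(f x + g x) / 2\<bar> powr p) \<partial>M)
       \<le> ennreal (e + C / 2) * ((\<integral>\<^sup>+x. ennreal (\<bar>f x\<bar> powr p) \<partial>M) + (\<integral>\<^sup>+x. ennreal (\<bar>g x\<bar> powr p) \<partial>M))"
    using nn_integral_uniform_convex[OF p e] by blast
  define \<delta> where "\<delta> = min 1 (\<eta> / 2 / (C + 1))"
  have \<delta>: "0 < \<delta>" "\<delta> \<le> 1"
    using C \<eta> by (auto simp: \<delta>_def)
  have "C * \<delta> \<le> \<eta> / 2"
  proof -
    have "C * \<delta> \<le> (C + 1) * (\<eta> / 2 / (C + 1))"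
      using C \<delta> by (intro mult_mono) (auto simp: \<delta>_def)
    also have "\<dots> = \<eta> / 2"
      using C by (subst times_divide_eq_right, intro nonzero_mult_div_cancel_left) simp
    finally show ?thesis .
  qed
  moreover have "e * (2 * (D + \<delta>)) \<le> \<eta> / 2"
  proof -
    have "e * (2 * (D + \<delta>)) \<le> e * (2 * (D + 1))"
      using e \<delta> by (intro mult_left_mono) auto
    also have "\<dots> = 2 * (e * (D + 1))"
      by simp
    also have "e * (D + 1) = \<eta> / 4"
      using D by (intro iffD1[OF nonzero_eq_divide_eq e_def]) simp
    finally show ?thesis
      by simp
  qed
  ultimately have bound: "(e + C / 2) * (2 * (D + \<delta>)) \<le> \<eta> + C * D"
    by (simp add: algebra_simps)
  have "(\<integral>\<^sup>+x. ennreal (\<bar>f x - g x\<bar> powr p) \<partial>M) \<le> ennreal \<eta>"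
    if [measurable]: "f \<in> borel_measurable M" "g \<in> borel_measurable M"
      and f: "(\<integral>\<^sup>+x. ennreal (\<bar>f x\<bar> powr p) \<partial>M) \<le> ennreal (D + \<delta>)"
      and g: "(\<integral>\<^sup>+x. ennreal (\<bar>g x\<bar> powr p) \<partial>M) \<le> ennreal (D + \<delta>)"
      and m: "ennreal D \<le> (\<integral>\<^sup>+x. ennreal (\<bar>(f x + g x) / 2\<bar> powr p) \<partial>M)"
    for M :: "'a measure" and f g
  proof -
    have "(\<integral>\<^sup>+x. ennreal (\<bar>f x - g x\<bar> powr p) \<partial>M) + ennreal C * ennreal D
       \<le> (\<integral>\<^sup>+x. ennreal (\<bar>f x - g x\<bar> powr p) \<partial>M) + ennreal C * (\<integral>\<^sup>+x. ennreal (\<bar>(f x + g x) / 2\<bar> powr p) \<partial>M)"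
      by (intro add_mono mult_left_mono m) auto
    also have "\<dots> \<le> ennreal (e + C / 2) * ((\<integral>\<^sup>+x. ennreal (\<bar>f x\<bar> powr p) \<partial>M) + (\<integral>\<^sup>+x. ennreal (\<bar>g x\<bar> powr p) \<partial>M))"
      by (rule uc) fact+
    also have "\<dots> \<le> ennreal (e + C / 2) * (ennreal (D + \<delta>) + ennreal (D + \<delta>))"
      by (intro mult_left_mono add_mono f g) auto
    also have "\<dots> = ennreal ((e + C / 2) * (2 * (D + \<delta>)))"
      using e C D \<delta> by (simp flip: ennreal_plus ennreal_mult)
    also have "\<dots> \<le> ennreal (\<eta> + C * D)"
      by (intro ennreal_leI bound)
    also have "\<dots> = ennreal \<eta> + ennreal C * ennreal D"
      using C D \<eta> by (simp add: ennreal_mult)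
    finally show ?thesis
      using C D by (simp add: ennreal_mult[symmetric] add.commute[of _ "ennreal (C * D)"] ennreal_add_left_cancel_le)
  qed
  with \<delta>(1) show ?thesis
    by (rule that)
qed

text \<open>The Riesz-Fischer argument with weights. Along a fast subsequence the weighted sum of
  the \<open>p\<close>-th powers of the increments has finite integral, hence is finite almost
  everywhere. At such a point the increments are dominated by a geometric series, so they telescope
  to a limit.\<close>

lemma Lp_Cauchy_imp_AE_convergent_subseq:
  fixes f :: "nat \<Rightarrow> 'a \<Rightarrow> real" and p :: real
  assumes p: "0 < p" and [measurable]: "\<And>n. f n \<in> borel_measurable M"
    and Cauchy: "\<And>\<eta>. 0 < \<eta> \<Longrightarrow>
      \<exists>K. \<forall>n\<ge>K. \<forall>m\<ge>K. (\<integral>\<^sup>+x. ennreal (\<bar>f n x - f m x\<bar> powr p) \<partial>M) \<le> ennreal \<eta>"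
  obtains r g where "strict_mono (r :: nat \<Rightarrow> nat)" "g \<in> borel_measurable M"
    "AE x in M. (\<lambda>k. f (r k) x) \<longlonglongrightarrow> g x"
proof -
  \<comment> \<open>The \<open>p\<close>-th root of \<open>w k\<close> is \<open>2 ^ k\<close>, so a
    finite weighted sum forces increments of order \<open>(1 / 2) ^ k\<close>.\<close>
  define w where "w k = (2 powr p) ^ k" for k :: nat
  have w: "0 < w k" for k
    by (simp add: w_def)
  have "\<forall>k. \<exists>K. \<forall>n\<ge>K. \<forall>m\<ge>K. (\<integral>\<^sup>+x. ennreal (\<bar>f n x - f m x\<bar> powr p) \<partial>M) \<le> ennreal ((1 / 2) ^ k / w k)"
    using w by (intro allI Cauchy) simp
  then obtain K where K: "\<And>k n m. K k \<le> n \<Longrightarrow> K k \<le> m \<Longrightarrow>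
      (\<integral>\<^sup>+x. ennreal (\<bar>f n x - f m x\<bar> powr p) \<partial>M) \<le> ennreal ((1 / 2) ^ k / w k)"
    by metis
  \<comment> \<open>The partial sum dominates \<open>K k\<close>, and the added \<open>k\<close>
    makes the sequence strictly increasing.\<close>
  define r where "r k = (\<Sum>i\<le>k. K i) + k" for k
  have r: "strict_mono r"
    by (intro strict_monoI_Suc) (simp add: r_def)
  have Kr: "K k \<le> r k" for k
    unfolding r_def by (rule trans_le_add1[OF member_le_sum]) auto
  have Kr': "K k \<le> r (Suc k)" for k
    using Kr[of k] strict_monoD[OF r, of k "Suc k"] by simp
  define d where "d k x = f (r (Suc k)) x - f (r k) x" for k x
  have [measurable]: "d k \<in> borel_measurable M" for k
    unfolding d_def by measurable
  have "(\<integral>\<^sup>+x. (\<Sum>k. ennreal (w k * \<bar>d k x\<bar> powr p)) \<partial>M) = (\<Sum>k. \<integral>\<^sup>+x. ennreal (w k * \<bar>d k x\<bar> powr p) \<partial>M)"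
    by (intro nn_integral_suminf) measurable
  also have "\<dots> \<le> (\<Sum>k. ennreal ((1 / 2) ^ k))"
  proof (intro suminf_le)
    fix k
    have "(\<integral>\<^sup>+x. ennreal (w k * \<bar>d k x\<bar> powr p) \<partial>M) = ennreal (w k) * (\<integral>\<^sup>+x. ennreal (\<bar>d k x\<bar> powr p) \<partial>M)"
      using w[of k] by (simp add: ennreal_mult nn_integral_cmult)
    also have "\<dots> \<le> ennreal (w k) * ennreal ((1 / 2) ^ k / w k)"
      unfolding d_def by (intro mult_left_mono K Kr Kr') auto
    also have "\<dots> = ennreal ((1 / 2) ^ k)"
      using w[of k] by (simp flip: ennreal_mult)
    finally show "(\<integral>\<^sup>+x. ennreal (w k * \<bar>d k x\<bar> powr p) \<partial>M) \<le> ennreal ((1 / 2) ^ k)" .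
  qed auto
  also have "\<dots> = ennreal (\<Sum>k. (1 / 2) ^ k)"
    by (intro suminf_ennreal2) (auto intro: summable_geometric)
  finally have "(\<integral>\<^sup>+x. (\<Sum>k. ennreal (w k * \<bar>d k x\<bar> powr p)) \<partial>M) \<noteq> \<infinity>"
    by (auto simp: top_unique)
  then have "AE x in M. (\<Sum>k. ennreal (w k * \<bar>d k x\<bar> powr p)) \<noteq> \<infinity>"
    by (intro nn_integral_PInf_AE) measurable
  then have "AE x in M. (\<lambda>k. f (r k) x) \<longlonglongrightarrow> lim (\<lambda>k. f (r k) x)"
  proof eventually_elim
    case (elim x)
    then obtain S where S: "0 \<le> S" "(\<Sum>k. ennreal (w k * \<bar>d k x\<bar> powr p)) = ennreal S"
      by (cases "\<Sum>k. ennreal (w k * \<bar>d k x\<bar> powr p)") auto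
    have dS: "\<bar>d k x\<bar> \<le> S powr (1 / p) * (1 / 2) ^ k" for k
    proof -
      have "ennreal (w k * \<bar>d k x\<bar> powr p) \<le> (\<Sum>k. ennreal (w k * \<bar>d k x\<bar> powr p))"
        using sum_le_suminf[of "\<lambda>k. ennreal (w k * \<bar>d k x\<bar> powr p)" "{k}"] by simp
      then have "w k * \<bar>d k x\<bar> powr p \<le> S"
        using S by simp
      then have "(w k * \<bar>d k x\<bar> powr p) powr (1 / p) \<le> S powr (1 / p)"
        using p w[of k] by (intro powr_mono2) auto
      moreover have "w k = (2 ^ k) powr p"
        by (simp add: w_def powr_power[symmetric] powr_realpow[symmetric] powr_powr mult.commute)
      then have "(w k * \<bar>d k x\<bar> powr p) powr (1 / p) = 2 ^ k * \<bar>d k x\<bar>"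
        using p by (simp add: powr_mult powr_powr)
      ultimately show ?thesis
        by (simp add: field_simps power_one_over)
    qed
    have "summable (\<lambda>k. d k x)"
      by (rule summable_comparison_test'[where N = 0 and g = "\<lambda>k. S powr (1 / p) * (1 / 2) ^ k"])
         (use dS in \<open>auto intro!: summable_mult summable_geometric\<close>)
    then have "(\<lambda>n. f (r 0) x + (\<Sum>k<n. d k x)) \<longlonglongrightarrow> f (r 0) x + (\<Sum>k. d k x)"
      by (intro tendsto_intros summable_LIMSEQ)
    moreover have "f (r 0) x + (\<Sum>k<n. d k x) = f (r n) x" for n
      unfolding d_def by (subst sum_lessThan_telescope) simp
    ultimately have "convergent (\<lambda>k. f (r k) x)"
      by (auto simp: convergent_def)
    then show ?case
      by (simp add: convergent_LIMSEQ_iff)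
  qed
  moreover have "(\<lambda>x. lim (\<lambda>k. f (r k) x)) \<in> borel_measurable M"
    by measurable
  ultimately show ?thesis
    using r that by blast
qed

section \<open>Optimality of the quantile coupling\<close>

text \<open>Exponents down to -1 matter: for \<open>p < 2\<close> the kernel behaves like
  \<open>s powr (p - 2)\<close>, which is singular but integrable at 0.\<close>

lemma nn_integral_powr_from_0:
  fixes a c :: real
  assumes "-1 < a" "0 \<le> c"
  shows "(\<integral>\<^sup>+s. ennreal (s powr a * indicator {0..c} s) \<partial>lborel) = ennreal (c powr (a + 1) / (a + 1))"
proof (rule nn_integral_has_integral_lborel)
  show "((\<lambda>s. s powr a * indicator {0..c} s) has_integral c powr (a + 1) / (a + 1)) UNIV"
  proof -
    have "(\<lambda>s. s powr a * indicator {0..c} s) = (\<lambda>s. if s \<in> {0..c} then s powr a else 0)"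
      by (auto simp: indicator_def)
    then show ?thesis
      using has_integral_powr_from_0[OF assms] by (simp only: has_integral_restrict_UNIV)
  qed
qed auto

text \<open>The second derivative of \<open>s\<^sup>p\<close>, extended by zero. Integrating it over the triangle
  \<open>y \<le> v < u < x\<close> recovers \<open>(x - y)\<^sup>p\<close>, and a coupling enters the resulting layer-cake formula only
  through the probabilities of \<open>Y \<le> v \<and> u < X\<close>.\<close>

definition powr_kernel :: "real \<Rightarrow> real \<Rightarrow> real" where
  "powr_kernel p s = (if 0 < s then p * (p - 1) * s powr (p - 2) else 0)"

lemma measurable_powr_kernel [measurable]: "powr_kernel p \<in> borel_measurable borel"
  unfolding powr_kernel_def by measurable

text \<open>The substitution \<open>s = u - v\<close> integrates the second derivative over
  \<open>{0..u - y}\<close> and produces the first derivative at \<open>u - y\<close>.\<close>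

lemma powr_layer_inner:
  fixes p u y :: real
  assumes "1 < p"
  shows "(\<integral>\<^sup>+v. ennreal (powr_kernel p (u - v)) * indicator {y..} v \<partial>lborel)
    = ennreal (p * (u - y) powr (p - 1) * indicator {y..} u)"
proof -
  have "(\<integral>\<^sup>+v. ennreal (powr_kernel p (u - v)) * indicator {y..} v \<partial>lborel)
    = (\<integral>\<^sup>+s. ennreal (powr_kernel p s) * indicator {y..} (u - s) \<partial>lborel)"
    by (subst nn_integral_real_affine[where c = "-1" and t = u]) auto
  also have "\<dots> = ennreal (p * (u - y) powr (p - 1) * indicator {y..} u)"
  proof (cases "y \<le> u")
    case True
    have "(\<integral>\<^sup>+s. ennreal (powr_kernel p s) * indicator {y..} (u - s) \<partial>lborel)
        = (\<integral>\<^sup>+s. ennreal (p * (p - 1)) * ennreal (s powr (p - 2) * indicator {0..u - y} s) \<partial>lborel)"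
      using assms by (intro nn_integral_cong)
        (auto simp: powr_kernel_def indicator_def simp flip: ennreal_mult)
    also have "\<dots> = ennreal (p * (p - 1)) * ennreal ((u - y) powr (p - 1) / (p - 1))"
      using nn_integral_powr_from_0[of "p - 2" "u - y"] assms True by (simp add: nn_integral_cmult)
    also have "\<dots> = ennreal (p * (u - y) powr (p - 1))"
      using assms by (simp flip: ennreal_mult)
    finally show ?thesis
      using True by simp
  next
    case False
    then have "(\<integral>\<^sup>+s. ennreal (powr_kernel p s) * indicator {y..} (u - s) \<partial>lborel) = (\<integral>\<^sup>+(s::real). 0 \<partial>lborel)"
      by (intro nn_integral_cong) (auto simp: powr_kernel_def indicator_def)
    then show ?thesis
      using False by simp
  qed
  finally show ?thesis .
qed

text \<open>The second integration, over \<open>u\<close> between \<open>y\<close> and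
  \<open>x\<close>, turns the first derivative into the power itself. If \<open>x \<le> y\<close>
  the triangle is empty and the value is 0.\<close>

lemma powr_layer_half:
  fixes p x y :: real
  assumes "1 < p"
  shows "(\<integral>\<^sup>+u. \<integral>\<^sup>+v. ennreal (powr_kernel p (u - v)) * indicator {z. y \<le> snd z \<and> fst z < x} (u, v) \<partial>lborel \<partial>lborel)
    = ennreal (max 0 (x - y) powr p)"
proof -
  have "(\<integral>\<^sup>+u. \<integral>\<^sup>+v. ennreal (powr_kernel p (u - v)) * indicator {z. y \<le> snd z \<and> fst z < x} (u, v) \<partial>lborel \<partial>lborel)
     = (\<integral>\<^sup>+u. indicator {..<x} u * (\<integral>\<^sup>+v. ennreal (powr_kernel p (u - v)) * indicator {y..} v \<partial>lborel) \<partial>lborel)"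
    by (intro nn_integral_cong) (auto simp: indicator_def)
  also have "\<dots> = (\<integral>\<^sup>+u. indicator {..<x} u * ennreal (p * (u - y) powr (p - 1) * indicator {y..} u) \<partial>lborel)"
    by (simp add: powr_layer_inner[OF assms])
  also have "\<dots> = (\<integral>\<^sup>+s. indicator {..<x} (y + s) * ennreal (p * s powr (p - 1) * indicator {0..} s) \<partial>lborel)"
    by (subst nn_integral_real_affine[where c = 1 and t = y]) (auto simp: indicator_def intro!: nn_integral_cong)
  also have "\<dots> = (\<integral>\<^sup>+s. ennreal p * ennreal (s powr (p - 1) * indicator {0..max 0 (x - y)} s) \<partial>lborel)"
  proof (rule nn_integral_cong_AE)
    \<comment> \<open>The two integrands can differ only at the endpoints of the interval of
      integration, which are null.\<close>
    show "AE s in lborel. indicator {..<x} (y + s) * ennreal (p * s powr (p - 1) * indicator {0..} s)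
        = ennreal p * ennreal (s powr (p - 1) * indicator {0..max 0 (x - y)} s)"
      using AE_lborel_singleton[of "x - y"] AE_lborel_singleton[of 0]
    proof eventually_elim
      case (elim s)
      then show ?case
        using assms by (auto simp: indicator_def simp flip: ennreal_mult)
    qed
  qed
  also have "\<dots> = ennreal p * ennreal (max 0 (x - y) powr p / p)"
    using nn_integral_powr_from_0[of "p - 1" "max 0 (x - y)"] assms by (simp add: nn_integral_cmult)
  also have "\<dots> = ennreal (max 0 (x - y) powr p)"
    using assms by (simp flip: ennreal_mult)
  finally show ?thesis .
qed

text \<open>The layer formula is applied at each point of \<open>M\<close> with
  \<open>x = X \<omega>\<close> and \<open>y = Y \<omega>\<close>. Two applications of Tonelli then
  move the integral over \<open>M\<close> innermost, where the indicator integrates to a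
  probability.\<close>

lemma nn_integral_powr_layer_half:
  fixes p :: real
  assumes p: "1 < p" and "sigma_finite_measure M"
    and [measurable]: "X \<in> borel_measurable M" "Y \<in> borel_measurable M"
  shows "(\<integral>\<^sup>+\<omega>. ennreal (max 0 (X \<omega> - Y \<omega>) powr p) \<partial>M)
    = (\<integral>\<^sup>+u. \<integral>\<^sup>+v. ennreal (powr_kernel p (u - v)) *
         emeasure M {\<omega>\<in>space M. Y \<omega> \<le> v \<and> u < X \<omega>} \<partial>lborel \<partial>lborel)"
proof -
  interpret M: sigma_finite_measure M by fact
  interpret P: pair_sigma_finite M lborel ..
  have "(\<integral>\<^sup>+\<omega>. ennreal (max 0 (X \<omega> - Y \<omega>) powr p) \<partial>M)
    = (\<integral>\<^sup>+\<omega>. \<integral>\<^sup>+u. \<integral>\<^sup>+v. ennreal (powr_kernel p (u - v)) *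
         indicator {z. Y \<omega> \<le> snd z \<and> fst z < X \<omega>} (u, v) \<partial>lborel \<partial>lborel \<partial>M)"
    by (simp add: powr_layer_half[OF p])
  also have "\<dots> = (\<integral>\<^sup>+u. \<integral>\<^sup>+\<omega>. \<integral>\<^sup>+v. ennreal (powr_kernel p (u - v)) *
         indicator {z. Y \<omega> \<le> snd z \<and> fst z < X \<omega>} (u, v) \<partial>lborel \<partial>M \<partial>lborel)"
    by (subst P.Fubini') (auto simp: indicator_def[abs_def] split_beta')
  also have "\<dots> = (\<integral>\<^sup>+u. \<integral>\<^sup>+v. \<integral>\<^sup>+\<omega>. ennreal (powr_kernel p (u - v)) *
         indicator {z. Y \<omega> \<le> snd z \<and> fst z < X \<omega>} (u, v) \<partial>M \<partial>lborel \<partial>lborel)"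
    by (intro nn_integral_cong, subst P.Fubini') (auto simp: indicator_def[abs_def] split_beta')
  also have "\<dots> = (\<integral>\<^sup>+u. \<integral>\<^sup>+v. ennreal (powr_kernel p (u - v)) *
         emeasure M {\<omega>\<in>space M. Y \<omega> \<le> v \<and> u < X \<omega>} \<partial>lborel \<partial>lborel)"
  proof (intro nn_integral_cong)
    fix u v :: real
    have "(\<integral>\<^sup>+\<omega>. ennreal (powr_kernel p (u - v)) *
         indicator {z. Y \<omega> \<le> snd z \<and> fst z < X \<omega>} (u, v) \<partial>M)
      = (\<integral>\<^sup>+\<omega>. ennreal (powr_kernel p (u - v)) *
         indicator {\<omega>\<in>space M. Y \<omega> \<le> v \<and> u < X \<omega>} \<omega> \<partial>M)"
      by (intro nn_integral_cong) (auto simp: indicator_def)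
    also have "\<dots> = ennreal (powr_kernel p (u - v)) * emeasure M {\<omega>\<in>space M. Y \<omega> \<le> v \<and> u < X \<omega>}"
      by (intro nn_integral_cmult_indicator) measurable
    finally show "(\<integral>\<^sup>+\<omega>. ennreal (powr_kernel p (u - v)) *
         indicator {z. Y \<omega> \<le> snd z \<and> fst z < X \<omega>} (u, v) \<partial>M)
      = ennreal (powr_kernel p (u - v)) * emeasure M {\<omega>\<in>space M. Y \<omega> \<le> v \<and> u < X \<omega>}" .
  qed
  finally show ?thesis .
qed

text \<open>Since \<open>0 powr p = 0\<close>, the part of the wrong sign contributes nothing at
  each point.\<close>

lemma nn_integral_abs_powr_split:
  fixes p :: real
  assumes [measurable]: "X \<in> borel_measurable M" "Y \<in> borel_measurable M"
  shows "(\<integral>\<^sup>+\<omega>. ennreal (\<bar>X \<omega> - Y \<omega>\<bar> powr p) \<partial>M)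
    = (\<integral>\<^sup>+\<omega>. ennreal (max 0 (X \<omega> - Y \<omega>) powr p) \<partial>M) + (\<integral>\<^sup>+\<omega>. ennreal (max 0 (Y \<omega> - X \<omega>) powr p) \<partial>M)"
  by (subst nn_integral_add[symmetric]) (auto simp: max_def intro!: nn_integral_cong)

section \<open>Quantile functions as random variables on the unit interval\<close>

abbreviation unit_interval :: "real measure" where
  "unit_interval \<equiv> restrict_space lborel {0<..<1}"

lemma prob_space_unit_interval: "prob_space unit_interval"
  by (auto simp: emeasure_restrict_space space_restrict_space intro!: prob_spaceI)

text \<open>For \<open>t\<close> strictly between 0 and 1 the set in the definition of
  \<open>quantile\<close> is nonempty, bounded below and upward closed. Right continuity of the
  distribution function makes it contain its infimum.\<close>

lemma quantile_le_iff:
  assumes "real_distribution \<mu>" "0 < t" "t < 1"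
  shows "quantile \<mu> t \<le> x \<longleftrightarrow> t \<le> cdf \<mu> x"
proof -
  interpret cdf_distribution \<mu>
    using assms(1) by (rule cdf_distribution.intro)
  show ?thesis
    using pseudoinverse[of t x] assms unfolding quantile_def by simp
qed

lemma measurable_quantile:
  assumes "real_distribution \<mu>"
  shows "quantile \<mu> \<in> borel_measurable unit_interval"
proof -
  interpret cdf_distribution \<mu>
    using assms by (rule cdf_distribution.intro)
  show ?thesis
    using measurable_CI unfolding quantile_def[abs_def]
    by (simp cong: measurable_cong_sets sets_restrict_space_cong)
qed

lemma distr_quantile:
  assumes "real_distribution \<mu>"
  shows "distr unit_interval borel (quantile \<mu>) = \<mu>"
proof -
  interpret cdf_distribution \<mu>
    using assms by (rule cdf_distribution.intro)
  show ?thesis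
    using distr_I_eq_M unfolding quantile_def[abs_def] .
qed

text \<open>The quantile coupling attains the Hoeffding--Frechet lower bound
  \<open>max 0 (G v - F u)\<close>.\<close>

lemma quantile_crossing_le:
  fixes M :: "'a measure"
  assumes M: "prob_space M" and [measurable]: "X \<in> borel_measurable M" "Y \<in> borel_measurable M"
  shows "emeasure unit_interval {t\<in>space unit_interval.
            quantile (distr M borel Y) t \<le> v \<and> u < quantile (distr M borel X) t}
    \<le> emeasure M {\<omega>\<in>space M. Y \<omega> \<le> v \<and> u < X \<omega>}"
proof -
  interpret M: prob_space M by fact
  have X: "real_distribution (distr M borel X)" and Y: "real_distribution (distr M borel Y)"
    by (auto intro: M.real_distribution_distr)
  have cdfX: "cdf (distr M borel X) u = M.prob {\<omega>\<in>space M. X \<omega> \<le> u}"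
    and cdfY: "cdf (distr M borel Y) v = M.prob {\<omega>\<in>space M. Y \<omega> \<le> v}"
    by (auto simp: cdf_def measure_distr intro!: arg_cong[where f = M.prob])
  \<comment> \<open>By \<open>quantile_le_iff\<close> the crossing event is the set of
    \<open>t\<close> above the distribution function of \<open>X\<close> at \<open>u\<close> and at
    most that of \<open>Y\<close> at \<open>v\<close>, hence essentially an interval.\<close>
  have "emeasure unit_interval {t\<in>space unit_interval.
            quantile (distr M borel Y) t \<le> v \<and> u < quantile (distr M borel X) t}
    = emeasure lborel {t\<in>{0<..<1}. t \<le> cdf (distr M borel Y) v \<and> cdf (distr M borel X) u < t}"
    using quantile_le_iff[OF X, of _ u] quantile_le_iff[OF Y, of _ v]
    by (subst emeasure_restrict_space)
       (auto simp: space_restrict_space not_le[symmetric] intro!: arg_cong2[where f = emeasure])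
  also have "\<dots> \<le> emeasure lborel {cdf (distr M borel X) u..cdf (distr M borel Y) v}"
    by (intro emeasure_mono) auto
  \<comment> \<open>If the interval is empty the difference is negative, and \<open>ennreal\<close>
    truncates it to 0, the required length.\<close>
  also have "\<dots> \<le> ennreal (M.prob {\<omega>\<in>space M. Y \<omega> \<le> v} - M.prob {\<omega>\<in>space M. X \<omega> \<le> u})"
    by (simp add: cdfX cdfY ennreal_neg emeasure_lborel_Icc_eq)
  also have "\<dots> \<le> ennreal (M.prob {\<omega>\<in>space M. Y \<omega> \<le> v \<and> u < X \<omega>})"
  proof (intro ennreal_leI)
    have "M.prob {\<omega>\<in>space M. Y \<omega> \<le> v}
        \<le> M.prob ({\<omega>\<in>space M. Y \<omega> \<le> v \<and> u < X \<omega>} \<union> {\<omega>\<in>space M. X \<omega> \<le> u})"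
      by (intro M.finite_measure_mono) auto
    also have "\<dots> \<le> M.prob {\<omega>\<in>space M. Y \<omega> \<le> v \<and> u < X \<omega>} + M.prob {\<omega>\<in>space M. X \<omega> \<le> u}"
      by (intro measure_Un_le) auto
    finally show "M.prob {\<omega>\<in>space M. Y \<omega> \<le> v} - M.prob {\<omega>\<in>space M. X \<omega> \<le> u}
        \<le> M.prob {\<omega>\<in>space M. Y \<omega> \<le> v \<and> u < X \<omega>}" by simp
  qed
  finally show ?thesis
    by (simp add: M.emeasure_eq_measure)
qed

text \<open>In the layer formula a nonnegative kernel is integrated against crossing probabilities,
  and the quantile coupling makes all of these as small as possible simultaneously. Exchanging
  \<open>X\<close> and \<open>Y\<close> treats the negative part of the difference.\<close>

lemma quantile_coupling_optimal:
  fixes M :: "'a measure" and p :: real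
  assumes p: "1 < p" and M: "prob_space M"
    and [measurable]: "X \<in> borel_measurable M" "Y \<in> borel_measurable M"
  shows "(\<integral>\<^sup>+t. ennreal (\<bar>quantile (distr M borel X) t - quantile (distr M borel Y) t\<bar> powr p) \<partial>unit_interval)
    \<le> (\<integral>\<^sup>+\<omega>. ennreal (\<bar>X \<omega> - Y \<omega>\<bar> powr p) \<partial>M)"
proof -
  interpret M: prob_space M by fact
  interpret U: prob_space unit_interval by (rule prob_space_unit_interval)
  have half: "(\<integral>\<^sup>+t. ennreal (max 0 (quantile (distr M borel X) t - quantile (distr M borel Y) t) powr p) \<partial>unit_interval)
    \<le> (\<integral>\<^sup>+\<omega>. ennreal (max 0 (X \<omega> - Y \<omega>) powr p) \<partial>M)"
    if [measurable]: "X \<in> borel_measurable M" "Y \<in> borel_measurable M" for X Y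
  proof -
    have X: "real_distribution (distr M borel X)" and Y: "real_distribution (distr M borel Y)"
      by (auto intro: M.real_distribution_distr)
    show ?thesis
      unfolding nn_integral_powr_layer_half[OF p M.sigma_finite_measure_axioms that]
        nn_integral_powr_layer_half[OF p U.sigma_finite_measure_axioms
          measurable_quantile[OF X] measurable_quantile[OF Y]]
      by (intro nn_integral_mono mult_left_mono quantile_crossing_le M that) auto
  qed
  have X: "real_distribution (distr M borel X)" and Y: "real_distribution (distr M borel Y)"
    by (auto intro: M.real_distribution_distr)
  show ?thesis
    unfolding nn_integral_abs_powr_split[OF assms(3,4)]
      nn_integral_abs_powr_split[OF measurable_quantile[OF X] measurable_quantile[OF Y]]
    by (intro add_mono half) measurable
qed

text \<open>The \<open>p\<close>-th power of the distance, kept in \<open>ennreal\<close> so that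
  neither the root nor \<open>enn2real\<close> interferes with the estimates.\<close>

definition quantile_cost :: "real \<Rightarrow> real measure \<Rightarrow> real measure \<Rightarrow> ennreal" where
  "quantile_cost p \<mu> \<nu> = (\<integral>\<^sup>+t. ennreal (\<bar>quantile \<mu> t - quantile \<nu> t\<bar> powr p) \<partial>unit_interval)"

text \<open>The joint law of the two quantile functions is a coupling, which bounds the infimum from
  above. For the other inequality, optimality is applied to the coordinate projections under an
  arbitrary coupling.\<close>

lemma INF_couplings_eq:
  fixes p :: real
  assumes p: "1 < p" and \<mu>: "real_distribution \<mu>" and \<nu>: "real_distribution \<nu>"
  shows "(INF \<pi>\<in>couplings \<mu> \<nu>. \<integral>\<^sup>+z. ennreal (\<bar>fst z - snd z\<bar> powr p) \<partial>\<pi>) = quantile_cost p \<mu> \<nu>"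
proof (rule antisym)
  interpret U: prob_space unit_interval by (rule prob_space_unit_interval)
  note [measurable] = measurable_quantile[OF \<mu>] measurable_quantile[OF \<nu>]
  define \<pi> where "\<pi> = distr unit_interval (borel \<Otimes>\<^sub>M borel) (\<lambda>t. (quantile \<mu> t, quantile \<nu> t))"
  have "\<pi> \<in> couplings \<mu> \<nu>"
    unfolding couplings_def \<pi>_def
    by (auto intro!: U.prob_space_distr simp: distr_distr comp_def distr_quantile \<mu> \<nu>)
  then have "(INF \<pi>\<in>couplings \<mu> \<nu>. \<integral>\<^sup>+z. ennreal (\<bar>fst z - snd z\<bar> powr p) \<partial>\<pi>)
      \<le> (\<integral>\<^sup>+z. ennreal (\<bar>fst z - snd z\<bar> powr p) \<partial>\<pi>)"
    by (rule INF_lower)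
  also have "\<dots> = quantile_cost p \<mu> \<nu>"
    unfolding \<pi>_def quantile_cost_def by (subst nn_integral_distr) auto
  finally show "(INF \<pi>\<in>couplings \<mu> \<nu>. \<integral>\<^sup>+z. ennreal (\<bar>fst z - snd z\<bar> powr p) \<partial>\<pi>) \<le> quantile_cost p \<mu> \<nu>" .
next
  show "quantile_cost p \<mu> \<nu> \<le> (INF \<pi>\<in>couplings \<mu> \<nu>. \<integral>\<^sup>+z. ennreal (\<bar>fst z - snd z\<bar> powr p) \<partial>\<pi>)"
  proof (rule INF_greatest)
    fix \<pi> assume "\<pi> \<in> couplings \<mu> \<nu>"
    then have \<pi>: "prob_space \<pi>" and [measurable_cong]: "sets \<pi> = sets (borel \<Otimes>\<^sub>M borel)"
      and marginals: "distr \<pi> borel fst = \<mu>" "distr \<pi> borel snd = \<nu>"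
      by (auto simp: couplings_def)
    show "quantile_cost p \<mu> \<nu> \<le> (\<integral>\<^sup>+z. ennreal (\<bar>fst z - snd z\<bar> powr p) \<partial>\<pi>)"
      using quantile_coupling_optimal[OF p \<pi>, of fst snd]
      by (simp add: marginals quantile_cost_def)
  qed
qed

lemma Wp_eq_quantile_cost:
  "1 < p \<Longrightarrow> real_distribution \<mu> \<Longrightarrow> real_distribution \<nu> \<Longrightarrow>
    Wp p \<mu> \<nu> = enn2real (quantile_cost p \<mu> \<nu>) powr (1 / p)"
  by (simp add: Wp_def INF_couplings_eq)

text \<open>Bounds the cost through any joint realization of the two laws. It serves functions that
  need not be quantile functions: the limit of a minimizing sequence, and affine images with
  negative slope.\<close>

lemma quantile_cost_distr_le:
  fixes M :: "'a measure"
  assumes "1 < p" "prob_space M" "X \<in> borel_measurable M" "Y \<in> borel_measurable M"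
  shows "quantile_cost p (distr M borel X) (distr M borel Y)
    \<le> (\<integral>\<^sup>+\<omega>. ennreal (\<bar>X \<omega> - Y \<omega>\<bar> powr p) \<partial>M)"
  unfolding quantile_cost_def by (rule quantile_coupling_optimal[OF assms])

section \<open>Existence, uniqueness and equivariance of projections\<close>

lemma Pp_real_distribution: "\<mu> \<in> Pp p \<Longrightarrow> real_distribution \<mu>"
  by (simp add: Pp_def)

lemma distr_in_Pp:
  assumes M: "prob_space M" and [measurable]: "X \<in> borel_measurable M"
    and fin: "(\<integral>\<^sup>+\<omega>. ennreal (\<bar>X \<omega>\<bar> powr p) \<partial>M) < \<infinity>"
  shows "distr M borel X \<in> Pp p"
proof -
  interpret prob_space M by fact
  have "integrable M (\<lambda>\<omega>. \<bar>X \<omega>\<bar> powr p)"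
    by (rule integrableI_nonneg) (use fin in auto)
  then show ?thesis
    by (simp add: Pp_def real_distribution_distr integrable_distr_eq)
qed

lemma quantile_moment_finite:
  assumes "\<mu> \<in> Pp p"
  shows "(\<integral>\<^sup>+t. ennreal (\<bar>quantile \<mu> t\<bar> powr p) \<partial>unit_interval) < \<infinity>"
proof -
  have \<mu>: "real_distribution \<mu>" and int: "integrable \<mu> (\<lambda>x. \<bar>x\<bar> powr p)"
    using assms by (auto simp: Pp_def)
  note [measurable] = measurable_quantile[OF \<mu>]
  have "(\<integral>\<^sup>+t. ennreal (\<bar>quantile \<mu> t\<bar> powr p) \<partial>unit_interval)
      = (\<integral>\<^sup>+x. ennreal (\<bar>x\<bar> powr p) \<partial>distr unit_interval borel (quantile \<mu>))"
    by (subst nn_integral_distr) auto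
  also have "\<dots> < \<infinity>"
    using int by (simp add: distr_quantile[OF \<mu>] nn_integral_eq_integral)
  finally show ?thesis .
qed

lemma nn_integral_abs_add_powr_finite:
  fixes p :: real
  assumes "0 \<le> p" and [measurable]: "f \<in> borel_measurable M" "g \<in> borel_measurable M"
    and "(\<integral>\<^sup>+x. ennreal (\<bar>f x\<bar> powr p) \<partial>M) < \<infinity>" "(\<integral>\<^sup>+x. ennreal (\<bar>g x\<bar> powr p) \<partial>M) < \<infinity>"
  shows "(\<integral>\<^sup>+x. ennreal (\<bar>f x + g x\<bar> powr p) \<partial>M) < \<infinity>"
proof -
  have "(\<integral>\<^sup>+x. ennreal (\<bar>f x + g x\<bar> powr p) \<partial>M)
      \<le> (\<integral>\<^sup>+x. ennreal (2 powr p * (\<bar>f x\<bar> powr p + \<bar>g x\<bar> powr p)) \<partial>M)"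
    using assms(1) by (intro nn_integral_mono ennreal_leI abs_add_powr_le)
  also have "\<dots> = ennreal (2 powr p) * ((\<integral>\<^sup>+x. ennreal (\<bar>f x\<bar> powr p) \<partial>M) + (\<integral>\<^sup>+x. ennreal (\<bar>g x\<bar> powr p) \<partial>M))"
    by (simp add: ennreal_mult nn_integral_add nn_integral_cmult)
  also have "\<dots> < \<infinity>"
    using assms by (simp add: ennreal_mult_less_top)
  finally show ?thesis .
qed

lemma quantile_cost_finite:
  assumes p: "1 < p" and \<mu>: "\<mu> \<in> Pp p" and \<nu>: "\<nu> \<in> Pp p"
  shows "quantile_cost p \<mu> \<nu> < \<infinity>"
proof -
  note [measurable] = measurable_quantile[OF Pp_real_distribution[OF \<mu>]]
    measurable_quantile[OF Pp_real_distribution[OF \<nu>]]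
  show ?thesis
    using nn_integral_abs_add_powr_finite[of p "quantile \<mu>" unit_interval "\<lambda>t. - quantile \<nu> t"]
      quantile_moment_finite[OF \<mu>] quantile_moment_finite[OF \<nu>] p
    by (simp add: quantile_cost_def)
qed

text \<open>Both costs are finite on \<open>Pp p\<close>, so \<open>enn2real\<close> does not
  collapse infinity to 0, and the \<open>p\<close>-th root is strictly increasing.\<close>

lemma Wp_le_iff:
  assumes "1 < p" "\<mu> \<in> Pp p" "\<nu> \<in> Pp p" "\<mu>' \<in> Pp p" "\<nu>' \<in> Pp p"
  shows "Wp p \<mu> \<nu> \<le> Wp p \<mu>' \<nu>' \<longleftrightarrow> quantile_cost p \<mu> \<nu> \<le> quantile_cost p \<mu>' \<nu>'"
proof -
  have "quantile_cost p \<mu> \<nu> < top" "quantile_cost p \<mu>' \<nu>' < top"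
    using assms quantile_cost_finite by auto
  moreover have "x powr (1 / p) \<le> y powr (1 / p) \<longleftrightarrow> x \<le> y" if "0 \<le> x" "0 \<le> y" for x y
    using that assms(1) powr_mono2[of "1 / p" x y] powr_less_mono2[of "1 / p" y x] by force
  ultimately show ?thesis
    using assms
    by (cases "quantile_cost p \<mu> \<nu>"; cases "quantile_cost p \<mu>' \<nu>'")
       (auto simp: Wp_eq_quantile_cost Pp_real_distribution)
qed

text \<open>\<open>near_minimizers_close\<close> applied to the differences of the two quantile
  functions from that of \<open>\<mu>\<close>. Displacement convexity at \<open>t = 1 / 2\<close>
  makes their midpoint the difference belonging to a member of \<open>F\<close>, hence of cost at
  least \<open>D\<close>.\<close>

lemma near_projections_close:
  fixes p D \<eta> :: real
  assumes p: "1 < p" and F: "F \<subseteq> Pp p" "displacement_convex F" and \<mu>: "\<mu> \<in> Pp p"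
    and D: "0 \<le> D" "\<And>\<nu>. \<nu> \<in> F \<Longrightarrow> ennreal D \<le> quantile_cost p \<nu> \<mu>" and \<eta>: "0 < \<eta>"
  obtains \<delta> where "0 < \<delta>"
    "\<And>\<nu> \<nu>'. \<nu> \<in> F \<Longrightarrow> \<nu>' \<in> F \<Longrightarrow> quantile_cost p \<nu> \<mu> \<le> ennreal (D + \<delta>) \<Longrightarrow>
       quantile_cost p \<nu>' \<mu> \<le> ennreal (D + \<delta>) \<Longrightarrow> quantile_cost p \<nu> \<nu>' \<le> ennreal \<eta>"
proof -
  obtain \<delta> where \<delta>: "0 < \<delta>" and close: "\<And>(M :: real measure) f g. f \<in> borel_measurable M \<Longrightarrow> g \<in> borel_measurable M \<Longrightarrow>
       (\<integral>\<^sup>+x. ennreal (\<bar>f x\<bar> powr p) \<partial>M) \<le> ennreal (D + \<delta>) \<Longrightarrow>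
       (\<integral>\<^sup>+x. ennreal (\<bar>g x\<bar> powr p) \<partial>M) \<le> ennreal (D + \<delta>) \<Longrightarrow>
       ennreal D \<le> (\<integral>\<^sup>+x. ennreal (\<bar>(f x + g x) / 2\<bar> powr p) \<partial>M) \<Longrightarrow>
       (\<integral>\<^sup>+x. ennreal (\<bar>f x - g x\<bar> powr p) \<partial>M) \<le> ennreal \<eta>"
    using near_minimizers_close[OF p D(1) \<eta>] by blast
  have "quantile_cost p \<nu> \<nu>' \<le> ennreal \<eta>"
    if \<nu>: "\<nu> \<in> F" "\<nu>' \<in> F"
      and le: "quantile_cost p \<nu> \<mu> \<le> ennreal (D + \<delta>)" "quantile_cost p \<nu>' \<mu> \<le> ennreal (D + \<delta>)"
    for \<nu> \<nu>'
  proof -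
    have rd: "real_distribution \<nu>" "real_distribution \<nu>'" "real_distribution \<mu>"
      using \<nu> F(1) \<mu> Pp_real_distribution by auto
    note [measurable] = rd[THEN measurable_quantile]
    have "(1 / 2 :: real) \<in> {0..1}"
      by simp
    then obtain \<sigma> where \<sigma>: "\<sigma> \<in> F" "\<And>u. u \<in> {0<..<1} \<Longrightarrow>
        quantile \<sigma> u = (1 - 1 / 2) * quantile \<nu> u + 1 / 2 * quantile \<nu>' u"
      using F(2) \<nu> unfolding displacement_convex_def by blast
    have "ennreal D \<le> quantile_cost p \<sigma> \<mu>"
      by (rule D) fact
    also have "\<dots> = (\<integral>\<^sup>+t. ennreal (\<bar>((quantile \<nu> t - quantile \<mu> t) + (quantile \<nu>' t - quantile \<mu> t)) / 2\<bar> powr p)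
        \<partial>unit_interval)"
      unfolding quantile_cost_def
      by (intro nn_integral_cong) (simp add: \<sigma>(2) space_restrict_space field_simps)
    finally show ?thesis
      using close[of "\<lambda>t. quantile \<nu> t - quantile \<mu> t" unit_interval "\<lambda>t. quantile \<nu>' t - quantile \<mu> t"] le
      by (simp add: quantile_cost_def)
  qed
  with \<delta> show ?thesis
    by (rule that)
qed

lemma quantile_cost_eq_0_imp_eq:
  assumes \<mu>: "real_distribution \<mu>" and \<nu>: "real_distribution \<nu>" and 0: "quantile_cost p \<mu> \<nu> = 0"
  shows "\<mu> = \<nu>"
proof -
  note [measurable] = measurable_quantile[OF \<mu>] measurable_quantile[OF \<nu>]
  have "AE t in unit_interval. ennreal (\<bar>quantile \<mu> t - quantile \<nu> t\<bar> powr p) = 0"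
    using 0 unfolding quantile_cost_def by (subst (asm) nn_integral_0_iff_AE) auto
  then have "AE t in unit_interval. quantile \<mu> t = quantile \<nu> t"
    by eventually_elim (auto simp: ennreal_eq_0_iff)
  then have "distr unit_interval borel (quantile \<mu>) = distr unit_interval borel (quantile \<nu>)"
    by (intro distr_cong_AE) auto
  then show ?thesis
    by (simp add: distr_quantile \<mu> \<nu>)
qed

text \<open>Two exact minimizers are near-minimizers for every \<open>\<delta>\<close>, so the cost
  between them is below every positive \<open>\<eta>\<close>.\<close>

lemma projection_unique:
  assumes p: "1 < p" and F: "F \<subseteq> Pp p" "displacement_convex F" and \<mu>: "\<mu> \<in> Pp p"
    and \<sigma>: "\<sigma> \<in> F" "\<And>\<nu>. \<nu> \<in> F \<Longrightarrow> quantile_cost p \<sigma> \<mu> \<le> quantile_cost p \<nu> \<mu>"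
    and \<sigma>': "\<sigma>' \<in> F" "\<And>\<nu>. \<nu> \<in> F \<Longrightarrow> quantile_cost p \<sigma>' \<mu> \<le> quantile_cost p \<nu> \<mu>"
  shows "\<sigma> = \<sigma>'"
proof -
  have "quantile_cost p \<sigma> \<mu> < top"
    using quantile_cost_finite[OF p _ \<mu>, of \<sigma>] \<sigma>(1) F(1) by auto
  then obtain D where D: "0 \<le> D" "quantile_cost p \<sigma> \<mu> = ennreal D"
    by (cases "quantile_cost p \<sigma> \<mu>") auto
  have eps: "quantile_cost p \<sigma> \<sigma>' \<le> ennreal \<eta>" if \<eta>: "0 < \<eta>" for \<eta>
  proof -
    have lower: "ennreal D \<le> quantile_cost p \<nu> \<mu>" if "\<nu> \<in> F" for \<nu>
      using \<sigma>(2)[OF that] D by simp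
    obtain \<delta> where \<delta>: "0 < \<delta>" "\<And>\<nu> \<nu>'. \<nu> \<in> F \<Longrightarrow> \<nu>' \<in> F \<Longrightarrow> quantile_cost p \<nu> \<mu> \<le> ennreal (D + \<delta>) \<Longrightarrow>
       quantile_cost p \<nu>' \<mu> \<le> ennreal (D + \<delta>) \<Longrightarrow> quantile_cost p \<nu> \<nu>' \<le> ennreal \<eta>"
      using near_projections_close[OF p F \<mu> D(1) lower \<eta>] by blast
    have "quantile_cost p \<sigma> \<mu> \<le> ennreal (D + \<delta>)"
      using D \<delta>(1) by (simp add: ennreal_leI)
    moreover from this have "quantile_cost p \<sigma>' \<mu> \<le> ennreal (D + \<delta>)"
      using \<sigma>'(2)[OF \<sigma>(1)] by (rule order_trans[rotated])
    ultimately show ?thesis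
      by (intro \<delta>(2) \<sigma>(1) \<sigma>'(1))
  qed
  have "quantile_cost p \<sigma> \<sigma>' \<le> 0"
    by (rule ennreal_le_epsilon) (simp add: eps)
  moreover have "real_distribution \<sigma>" "real_distribution \<sigma>'"
    using \<sigma>(1) \<sigma>'(1) F(1) Pp_real_distribution by auto
  ultimately show ?thesis
    by (intro quantile_cost_eq_0_imp_eq) auto
qed

lemma powr_tendsto_0:
  fixes p :: real and f :: "nat \<Rightarrow> real"
  assumes "f \<longlonglongrightarrow> 0" "0 < p" "\<And>n. 0 \<le> f n"
  shows "(\<lambda>n. f n powr p) \<longlonglongrightarrow> 0"
proof -
  have "(\<lambda>n. f n powr p) \<longlonglongrightarrow> 0 powr p"
    by (rule tendsto_powr'[OF assms(1) tendsto_const]) (use assms in auto)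
  then show ?thesis
    using assms(2) by simp
qed

lemma projection_exists:
  assumes p: "1 < p" and F: "F \<noteq> {}" "F \<subseteq> Pp p" "displacement_convex F" "Wp_closed p F"
    and \<mu>: "\<mu> \<in> Pp p"
  obtains \<sigma> where "\<sigma> \<in> F" "\<And>\<nu>. \<nu> \<in> F \<Longrightarrow> quantile_cost p \<sigma> \<mu> \<le> quantile_cost p \<nu> \<mu>"
proof -
  interpret U: prob_space unit_interval by (rule prob_space_unit_interval)
  have \<mu>': "real_distribution \<mu>"
    using \<mu> by (rule Pp_real_distribution)
  note [measurable] = measurable_quantile[OF \<mu>']
  obtain \<nu>0 where "\<nu>0 \<in> F"
    using F(1) by auto
  then have "(INF \<nu>\<in>F. quantile_cost p \<nu> \<mu>) \<le> quantile_cost p \<nu>0 \<mu>"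
    by (rule INF_lower)
  also have "\<dots> < top"
    using quantile_cost_finite[OF p _ \<mu>] \<open>\<nu>0 \<in> F\<close> F(2) by auto
  finally obtain D where D: "0 \<le> D" "(INF \<nu>\<in>F. quantile_cost p \<nu> \<mu>) = ennreal D"
    by (cases "INF \<nu>\<in>F. quantile_cost p \<nu> \<mu>") auto
  have lower: "ennreal D \<le> quantile_cost p \<nu> \<mu>" if "\<nu> \<in> F" for \<nu>
    using INF_lower[OF that, of "\<lambda>\<nu>. quantile_cost p \<nu> \<mu>"] D by simp
  have "\<exists>\<nu>\<in>F. quantile_cost p \<nu> \<mu> < ennreal (D + 1 / Suc n)" for n
  proof -
    have "(INF \<nu>\<in>F. quantile_cost p \<nu> \<mu>) < ennreal (D + 1 / Suc n)"
      using D by (simp add: ennreal_less_iff)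
    then show ?thesis
      by (simp add: INF_less_iff)
  qed
  then obtain \<nu> where \<nu>F: "\<And>n. \<nu> n \<in> F"
    and upper: "\<And>n. quantile_cost p (\<nu> n) \<mu> < ennreal (D + 1 / Suc n)"
    by metis
  have \<nu>P: "\<nu> n \<in> Pp p" for n
    using \<nu>F F(2) by auto
  have \<nu>: "real_distribution (\<nu> n)" for n
    using \<nu>P by (rule Pp_real_distribution)
  note [measurable] = \<nu>[THEN measurable_quantile]
  have Cauchy: "\<exists>K. \<forall>n\<ge>K. \<forall>m\<ge>K. quantile_cost p (\<nu> n) (\<nu> m) \<le> ennreal \<eta>" if \<eta>: "0 < \<eta>" for \<eta>
  proof -
    obtain \<delta> where \<delta>: "0 < \<delta>" "\<And>\<nu> \<nu>'. \<nu> \<in> F \<Longrightarrow> \<nu>' \<in> F \<Longrightarrow> quantile_cost p \<nu> \<mu> \<le> ennreal (D + \<delta>) \<Longrightarrow>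
       quantile_cost p \<nu>' \<mu> \<le> ennreal (D + \<delta>) \<Longrightarrow> quantile_cost p \<nu> \<nu>' \<le> ennreal \<eta>"
      using near_projections_close[OF p F(2,3) \<mu> D(1) lower \<eta>] by blast
    obtain K where K: "1 / Suc K < \<delta>"
      using \<delta>(1) nat_approx_posE by blast
    have "quantile_cost p (\<nu> n) \<mu> \<le> ennreal (D + \<delta>)" if "K \<le> n" for n
    proof -
      have "1 / Suc n \<le> 1 / real (Suc K)"
        using that by (intro divide_left_mono) auto
      then have "ennreal (D + 1 / Suc n) \<le> ennreal (D + \<delta>)"
        using K by (intro ennreal_leI) simp
      with upper[of n] show ?thesis by simp
    qed
    then show ?thesis
      using \<delta>(2) \<nu>F by blast
  qed
  obtain r g where r: "strict_mono r" and g[measurable]: "g \<in> borel_measurable unit_interval"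
    and lim: "AE t in unit_interval. (\<lambda>k. quantile (\<nu> (r k)) t) \<longlonglongrightarrow> g t"
    using Lp_Cauchy_imp_AE_convergent_subseq[of p "\<lambda>n. quantile (\<nu> n)" unit_interval] p Cauchy
    by (auto simp: quantile_cost_def)
  \<comment> \<open>Stated for general \<open>h\<close> because it serves twice: with the quantile
    function of a term of the sequence, to get convergence to the limit, and with that of
    \<open>\<mu>\<close>, to get minimality.\<close>
  have Fatou: "(\<integral>\<^sup>+t. ennreal (\<bar>h t - g t\<bar> powr p) \<partial>unit_interval)
      \<le> liminf (\<lambda>k. \<integral>\<^sup>+t. ennreal (\<bar>h t - quantile (\<nu> (r k)) t\<bar> powr p) \<partial>unit_interval)"
    if [measurable]: "h \<in> borel_measurable unit_interval" for h
  proof -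
    have "AE t in unit_interval. ennreal (\<bar>h t - g t\<bar> powr p)
        = liminf (\<lambda>k. ennreal (\<bar>h t - quantile (\<nu> (r k)) t\<bar> powr p))"
      using lim
    proof eventually_elim
      case (elim t)
      have "(\<lambda>k. ennreal (\<bar>h t - quantile (\<nu> (r k)) t\<bar> powr p)) \<longlonglongrightarrow> ennreal (\<bar>h t - g t\<bar> powr p)"
        using p by (intro tendsto_intros tendsto_powr' elim) auto
      then show ?case
        by (intro lim_imp_Liminf[symmetric]) auto
    qed
    then have "(\<integral>\<^sup>+t. ennreal (\<bar>h t - g t\<bar> powr p) \<partial>unit_interval)
        = (\<integral>\<^sup>+t. liminf (\<lambda>k. ennreal (\<bar>h t - quantile (\<nu> (r k)) t\<bar> powr p)) \<partial>unit_interval)"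
      by (rule nn_integral_cong_AE)
    also have "\<dots> \<le> liminf (\<lambda>k. \<integral>\<^sup>+t. ennreal (\<bar>h t - quantile (\<nu> (r k)) t\<bar> powr p) \<partial>unit_interval)"
      by (intro nn_integral_liminf) measurable
    finally show ?thesis .
  qed
  define \<sigma> where "\<sigma> = distr unit_interval borel g"
  \<comment> \<open>Convergence of the whole sequence, not only of the subsequence: for fixed
    \<open>n\<close> the Cauchy bound is passed to the limit along \<open>r\<close> in the other
    index.\<close>
  have close: "\<exists>K. \<forall>n\<ge>K. (\<integral>\<^sup>+t. ennreal (\<bar>quantile (\<nu> n) t - g t\<bar> powr p) \<partial>unit_interval) \<le> ennreal \<eta>"
    if \<eta>: "0 < \<eta>" for \<eta>
  proof -
    obtain K where K: "\<And>n m. K \<le> n \<Longrightarrow> K \<le> m \<Longrightarrow> quantile_cost p (\<nu> n) (\<nu> m) \<le> ennreal \<eta>"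
      using Cauchy[OF \<eta>] by blast
    have "(\<integral>\<^sup>+t. ennreal (\<bar>quantile (\<nu> n) t - g t\<bar> powr p) \<partial>unit_interval) \<le> ennreal \<eta>" if "K \<le> n" for n
    proof -
      have "(\<integral>\<^sup>+t. ennreal (\<bar>quantile (\<nu> n) t - g t\<bar> powr p) \<partial>unit_interval)
          \<le> liminf (\<lambda>k. quantile_cost p (\<nu> n) (\<nu> (r k)))"
        unfolding quantile_cost_def by (rule Fatou) measurable
      also have "\<dots> \<le> ennreal \<eta>"
        using K[OF that] seq_suble[OF r] by (intro Liminf_le eventually_sequentiallyI[of K]) (auto intro: order_trans)
      finally show ?thesis .
    qed
    then show ?thesis by blast
  qed
  have \<sigma>P: "\<sigma> \<in> Pp p"
    unfolding \<sigma>_def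
  proof (rule distr_in_Pp[OF U.prob_space_axioms g])
    obtain K where "(\<integral>\<^sup>+t. ennreal (\<bar>quantile (\<nu> K) t - g t\<bar> powr p) \<partial>unit_interval) \<le> ennreal 1"
      using close[of 1] by auto
    then have "(\<integral>\<^sup>+t. ennreal (\<bar>g t - quantile (\<nu> K) t\<bar> powr p) \<partial>unit_interval) < \<infinity>"
      by (simp add: abs_minus_commute le_less_trans)
    \<comment> \<open>The limit inherits a finite moment by being written as a small perturbation
      plus a quantile function from \<open>Pp p\<close>.\<close>
    then have "(\<integral>\<^sup>+t. ennreal (\<bar>(g t - quantile (\<nu> K) t) + quantile (\<nu> K) t\<bar> powr p) \<partial>unit_interval) < \<infinity>"
      using quantile_moment_finite[OF \<nu>P] p by (intro nn_integral_abs_add_powr_finite) auto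
    then show "(\<integral>\<^sup>+t. ennreal (\<bar>g t\<bar> powr p) \<partial>unit_interval) < \<infinity>"
      by simp
  qed
  have cost_\<sigma>: "quantile_cost p (distr unit_interval borel f) \<sigma>
      \<le> (\<integral>\<^sup>+t. ennreal (\<bar>f t - g t\<bar> powr p) \<partial>unit_interval)"
    if "f \<in> borel_measurable unit_interval" for f
    unfolding \<sigma>_def by (rule quantile_cost_distr_le[OF p U.prob_space_axioms that g])
  have "(\<lambda>n. enn2real (quantile_cost p (\<nu> n) \<sigma>)) \<longlonglongrightarrow> 0"
  proof (rule LIMSEQ_I)
    fix \<eta> :: real assume \<eta>: "0 < \<eta>"
    then obtain K where K: "\<And>n. K \<le> n \<Longrightarrow>
        (\<integral>\<^sup>+t. ennreal (\<bar>quantile (\<nu> n) t - g t\<bar> powr p) \<partial>unit_interval) \<le> ennreal (\<eta> / 2)"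
      using close[of "\<eta> / 2"] by auto
    have "enn2real (quantile_cost p (\<nu> n) \<sigma>) < \<eta>" if "K \<le> n" for n
    proof -
      have "quantile_cost p (\<nu> n) \<sigma> \<le> ennreal (\<eta> / 2)"
        using order_trans[OF cost_\<sigma>[of "quantile (\<nu> n)"] K[OF that]] measurable_quantile[OF \<nu>]
        by (simp add: distr_quantile[OF \<nu>])
      then have "enn2real (quantile_cost p (\<nu> n) \<sigma>) \<le> \<eta> / 2"
        using \<eta> by (intro enn2real_leI) auto
      then show ?thesis
        using \<eta> by simp
    qed
    then show "\<exists>K. \<forall>n\<ge>K. norm (enn2real (quantile_cost p (\<nu> n) \<sigma>) - 0) < \<eta>"
      by auto
  qed
  then have "(\<lambda>n. Wp p (\<nu> n) \<sigma>) \<longlonglongrightarrow> 0"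
    using p by (simp add: Wp_eq_quantile_cost[OF p \<nu> Pp_real_distribution[OF \<sigma>P]] powr_tendsto_0)
  then have "\<sigma> \<in> F"
    using F(4) \<nu>F \<sigma>P unfolding Wp_closed_def by blast
  moreover have "quantile_cost p \<sigma> \<mu> \<le> quantile_cost p \<nu>' \<mu>" if "\<nu>' \<in> F" for \<nu>'
  proof -
    have sym: "quantile_cost p a b = quantile_cost p b a" for a b
      by (simp add: quantile_cost_def abs_minus_commute)
    have "quantile_cost p \<mu> \<sigma> \<le> (\<integral>\<^sup>+t. ennreal (\<bar>quantile \<mu> t - g t\<bar> powr p) \<partial>unit_interval)"
      using cost_\<sigma>[of "quantile \<mu>"] by (simp add: distr_quantile[OF \<mu>'])
    also have "\<dots> \<le> liminf (\<lambda>k. quantile_cost p \<mu> (\<nu> (r k)))"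
      unfolding quantile_cost_def by (rule Fatou) measurable
    also have "\<dots> \<le> liminf (\<lambda>k. ennreal (D + 1 / Suc (r k)))"
      using upper by (intro Liminf_mono always_eventually allI less_imp_le) (simp add: sym[of \<mu>])
    also have "\<dots> = ennreal D"
    proof (rule lim_imp_Liminf)
      have "(\<lambda>n. ennreal (D + 1 / Suc n)) \<longlonglongrightarrow> ennreal (D + 0)"
        by (intro tendsto_intros LIMSEQ_Suc lim_1_over_n)
      then show "(\<lambda>k. ennreal (D + 1 / Suc (r k))) \<longlonglongrightarrow> ennreal D"
        using LIMSEQ_subseq_LIMSEQ[OF _ r] by (fastforce simp: comp_def)
    qed simp
    also have "\<dots> \<le> quantile_cost p \<nu>' \<mu>"
      by (rule lower[OF that])
    finally show ?thesis
      by (simp add: sym[of \<mu>])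
  qed
  ultimately show ?thesis
    by (rule that)
qed

lemma is_arg_min_Wp_iff:
  assumes "1 < p" "F \<subseteq> Pp p" "\<mu> \<in> Pp p"
  shows "is_arg_min (\<lambda>\<nu>. Wp p \<nu> \<mu>) (\<lambda>\<nu>. \<nu> \<in> F) \<sigma> \<longleftrightarrow>
    \<sigma> \<in> F \<and> (\<forall>\<nu>\<in>F. quantile_cost p \<sigma> \<mu> \<le> quantile_cost p \<nu> \<mu>)"
proof -
  have "Wp p \<sigma> \<mu> \<le> Wp p \<nu> \<mu> \<longleftrightarrow> quantile_cost p \<sigma> \<mu> \<le> quantile_cost p \<nu> \<mu>" if "\<sigma> \<in> F" "\<nu> \<in> F" for \<nu>
    using assms that by (intro Wp_le_iff) auto
  then show ?thesis
    by (auto simp: is_arg_min_linorder)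
qed

text \<open>Gives meaning to the definite description in \<open>proj\<close>.\<close>

lemma ex1_is_arg_min_Wp:
  assumes "1 < p" "F \<noteq> {}" "F \<subseteq> Pp p" "displacement_convex F" "Wp_closed p F" "\<mu> \<in> Pp p"
  shows "\<exists>!\<sigma>. is_arg_min (\<lambda>\<nu>. Wp p \<nu> \<mu>) (\<lambda>\<nu>. \<nu> \<in> F) \<sigma>"
proof -
  obtain \<sigma> where "\<sigma> \<in> F" "\<And>\<nu>. \<nu> \<in> F \<Longrightarrow> quantile_cost p \<sigma> \<mu> \<le> quantile_cost p \<nu> \<mu>"
    using projection_exists[OF assms] by blast
  then show ?thesis
    unfolding is_arg_min_Wp_iff[OF assms(1,3,6)]
    using projection_unique[OF assms(1,3,4,6)] by (intro ex1I[of _ \<sigma>]) auto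
qed

section \<open>Affine images and equivariance\<close>

lemma distr_affine_in_Pp:
  assumes p: "1 < p" and \<mu>: "\<mu> \<in> Pp p"
  shows "distr \<mu> borel (\<lambda>x. a + b * x) \<in> Pp p"
proof -
  have rd: "real_distribution \<mu>" and int: "integrable \<mu> (\<lambda>x. \<bar>x\<bar> powr p)"
    using \<mu> by (auto simp: Pp_def)
  interpret real_distribution \<mu> by fact
  have "(\<integral>\<^sup>+x. ennreal (\<bar>x\<bar> powr p) \<partial>\<mu>) < \<infinity>"
    using int by (simp add: nn_integral_eq_integral)
  then have "(\<integral>\<^sup>+x. ennreal (\<bar>b * x\<bar> powr p) \<partial>\<mu>) < \<infinity>"
    by (simp add: abs_mult powr_mult ennreal_mult nn_integral_cmult ennreal_mult_less_top)
  then have "(\<integral>\<^sup>+x. ennreal (\<bar>a + b * x\<bar> powr p) \<partial>\<mu>) < \<infinity>"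
    using p by (intro nn_integral_abs_add_powr_finite) (auto simp: emeasure_space_1[unfolded space_eq_univ] ennreal_mult_less_top)
  then show ?thesis
    by (intro distr_in_Pp prob_space_axioms) auto
qed

text \<open>The affine images of the two quantile functions realize the two image laws jointly. For
  \<open>b < 0\<close> these images are decreasing, so they enter only as a realization, which
  yields an inequality.\<close>

lemma quantile_cost_distr_affine_le:
  assumes p: "1 < p" and \<mu>: "real_distribution \<mu>" and \<nu>: "real_distribution \<nu>"
  shows "quantile_cost p (distr \<mu> borel (\<lambda>x. a + b * x)) (distr \<nu> borel (\<lambda>x. a + b * x))
    \<le> ennreal (\<bar>b\<bar> powr p) * quantile_cost p \<mu> \<nu>"
proof -
  interpret U: prob_space unit_interval by (rule prob_space_unit_interval)
  note [measurable] = measurable_quantile[OF \<mu>] measurable_quantile[OF \<nu>]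
  have "distr unit_interval borel (\<lambda>t. a + b * quantile \<kappa> t) = distr \<kappa> borel (\<lambda>x. a + b * x)"
    if \<kappa>: "real_distribution \<kappa>" for \<kappa>
    using distr_distr[of "\<lambda>x. a + b * x" borel borel "quantile \<kappa>" unit_interval] measurable_quantile[OF \<kappa>]
    by (simp add: distr_quantile[OF \<kappa>] comp_def)
  then have "quantile_cost p (distr \<mu> borel (\<lambda>x. a + b * x)) (distr \<nu> borel (\<lambda>x. a + b * x))
      \<le> (\<integral>\<^sup>+t. ennreal (\<bar>(a + b * quantile \<mu> t) - (a + b * quantile \<nu> t)\<bar> powr p) \<partial>unit_interval)"
    using quantile_cost_distr_le[OF p U.prob_space_axioms, of "\<lambda>t. a + b * quantile \<mu> t" "\<lambda>t. a + b * quantile \<nu> t"] \<mu> \<nu>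
    by simp
  also have "\<dots> = (\<integral>\<^sup>+t. ennreal (\<bar>b\<bar> powr p) * ennreal (\<bar>quantile \<mu> t - quantile \<nu> t\<bar> powr p) \<partial>unit_interval)"
    by (intro nn_integral_cong) (simp flip: ennreal_mult powr_mult abs_mult right_diff_distrib)
  also have "\<dots> = ennreal (\<bar>b\<bar> powr p) * quantile_cost p \<mu> \<nu>"
    unfolding quantile_cost_def by (intro nn_integral_cmult) measurable
  finally show ?thesis .
qed

text \<open>The reverse inequality is the previous bound for the inverse map, whose slope
  \<open>1 / b\<close> supplies the reciprocal factor.\<close>

lemma quantile_cost_distr_affine:
  assumes p: "1 < p" and b: "b \<noteq> 0" and \<mu>: "real_distribution \<mu>" and \<nu>: "real_distribution \<nu>"
  shows "quantile_cost p (distr \<mu> borel (\<lambda>x. a + b * x)) (distr \<nu> borel (\<lambda>x. a + b * x))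
    = ennreal (\<bar>b\<bar> powr p) * quantile_cost p \<mu> \<nu>" (is "quantile_cost p ?\<mu> ?\<nu> = _")
proof (rule antisym)
  have inv: "distr (distr \<kappa> borel (\<lambda>x. a + b * x)) borel (\<lambda>x. - a / b + 1 / b * x) = \<kappa>"
    and rd: "real_distribution (distr \<kappa> borel (\<lambda>x. a + b * x))"
    if \<kappa>: "real_distribution \<kappa>" for \<kappa>
  proof -
    interpret real_distribution \<kappa> by fact
    have "distr (distr \<kappa> borel (\<lambda>x. a + b * x)) borel (\<lambda>x. - a / b + 1 / b * x)
        = distr \<kappa> borel (\<lambda>x. - a / b + 1 / b * (a + b * x))"
      by (subst distr_distr) (auto simp: comp_def)
    also have "\<dots> = distr \<kappa> \<kappa> (\<lambda>x. x)"
      using b by (intro distr_cong) (auto simp: field_simps)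
    finally show "distr (distr \<kappa> borel (\<lambda>x. a + b * x)) borel (\<lambda>x. - a / b + 1 / b * x) = \<kappa>"
      by (simp add: distr_id2)
    show "real_distribution (distr \<kappa> borel (\<lambda>x. a + b * x))"
      by (intro real_distribution_distr) auto
  qed
  have "ennreal (\<bar>b\<bar> powr p) * quantile_cost p \<mu> \<nu>
      \<le> ennreal (\<bar>b\<bar> powr p) * (ennreal (\<bar>1 / b\<bar> powr p) * quantile_cost p ?\<mu> ?\<nu>)"
    using quantile_cost_distr_affine_le[OF p rd[OF \<mu>] rd[OF \<nu>], of "- a / b" "1 / b"]
    by (intro mult_left_mono) (auto simp only: inv \<mu> \<nu> zero_le)
  also have "\<dots> = quantile_cost p ?\<mu> ?\<nu>"
    using b by (simp add: mult.assoc[symmetric] abs_divide flip: ennreal_mult powr_mult)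
  finally show "ennreal (\<bar>b\<bar> powr p) * quantile_cost p \<mu> \<nu> \<le> quantile_cost p ?\<mu> ?\<nu>" .
qed (rule quantile_cost_distr_affine_le[OF p \<mu> \<nu>])

theorem proposition2p11:
  fixes p a b :: real and F :: "real measure set" and T :: "real \<Rightarrow> real" and \<mu> :: "real measure"
  assumes "1 < p"
    and "F \<noteq> {}" and "F \<subseteq> Pp p"
    and "displacement_convex F" and "Wp_closed p F"
    and "b \<noteq> 0" and "\<And>x. T x = a + b * x"
    and "F = (\<lambda>\<nu>. distr \<nu> borel T) ` F"
    and "\<mu> \<in> Pp p"
  shows "proj p F (distr \<mu> borel T) = distr (proj p F \<mu>) borel T"
proof -
  have T: "T = (\<lambda>x. a + b * x)"
    using assms(7) by auto
  have T\<mu>: "distr \<mu> borel T \<in> Pp p"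
    unfolding T using assms(1,9) by (rule distr_affine_in_Pp)
  have cost: "quantile_cost p (distr \<nu> borel T) (distr \<mu> borel T)
      = ennreal (\<bar>b\<bar> powr p) * quantile_cost p \<nu> \<mu>" if "\<nu> \<in> F" for \<nu>
    unfolding T using assms that by (intro quantile_cost_distr_affine Pp_real_distribution) auto
  have "is_arg_min (\<lambda>\<nu>. Wp p \<nu> \<mu>) (\<lambda>\<nu>. \<nu> \<in> F) (proj p F \<mu>)"
    unfolding proj_def by (rule theI'[OF ex1_is_arg_min_Wp]) fact+
  then have min: "proj p F \<mu> \<in> F"
    "\<And>\<nu>. \<nu> \<in> F \<Longrightarrow> quantile_cost p (proj p F \<mu>) \<mu> \<le> quantile_cost p \<nu> \<mu>"
    using is_arg_min_Wp_iff[OF assms(1,3,9)] by auto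
  \<comment> \<open>Invariance of \<open>F\<close> is used in both directions: here images of
    members are members, and below every competitor is itself such an image, so all costs scale by
    the same factor.\<close>
  have "distr (proj p F \<mu>) borel T \<in> F"
    using min(1) by (subst assms(8)) (rule imageI)
  moreover have "quantile_cost p (distr (proj p F \<mu>) borel T) (distr \<mu> borel T)
      \<le> quantile_cost p \<nu> (distr \<mu> borel T)" if "\<nu> \<in> F" for \<nu>
  proof -
    obtain \<kappa> where "\<kappa> \<in> F" "\<nu> = distr \<kappa> borel T"
      using \<open>\<nu> \<in> F\<close> by (subst (asm) assms(8)) auto
    then show ?thesis
      using min by (simp add: cost mult_left_mono)
  qed
  ultimately have "is_arg_min (\<lambda>\<nu>. Wp p \<nu> (distr \<mu> borel T)) (\<lambda>\<nu>. \<nu> \<in> F) (distr (proj p F \<mu>) borel T)"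
    using is_arg_min_Wp_iff[OF assms(1,3) T\<mu>] by simp
  then show ?thesis
    unfolding proj_def[of p F "distr \<mu> borel T"]
    by (rule the1_equality[OF ex1_is_arg_min_Wp[OF assms(1-5) T\<mu>]])
qed

end
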